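(* For every nonempty $S\subseteq\mathbb{N}$ such that the $S$-gap shift $X_S$ is non-sofic, $X_S$ is topologically direct prime.
   Context: **Subshifts.** For a finite nonempty alphabet $A$, $A^{\mathbb{Z}}$ has the product topology and $\sigma(x)[i]=x[i+1]$. A subshift is a nonempty closed $X\subseteq A^{\mathbb{Z}}$ with $\sigma(X)=X$. $L(X)$ is the set of finite words occurring in elements of $X$. A conjugacy between subshifts $X,Y$ is a bijection $F:X\to Y$ that is a sliding block code, i.e. for some integers $m\le a$ and some $f$, $F(x)[i]=f(x[i+m],\dots,x[i+a])$ for all $x\in X$, $i\in\mathbb{Z}$. For subshifts $Y\subseteq A^{\mathbb{Z}}$, $Z\subseteq B^{\mathbb{Z}}$, the product $Y\times Z$ is regarded as a subshift of $(A\times B)^{\mathbb{Z}}$. A subshift is trivial if it has exactly one element. $X$ is (topologically) direct prime if whenever $X$ is conjugate to $Y\times Z$ for subshifts $Y,Z$, then $Y$ or $Z$ is trivial. **Soficity.** For $x\in X$ let $x^+=x[0]x[1]\cdots$, $x^-=\cdots x[-2]x[-1]$, $X^+=\{x^+:x\in X\}$, and $\omega_X(x^-)=\{y^+\in X^+ : x^-y^+\in X\}$. $X$ is sofic if $\{\omega_X(x^-):x\in X\}$ is a finite set. **$S$-gap shifts.** For nonempty $S\subseteq\mathbb{N}=\{0,1,2,\dots\}$, the $S$-gap shift $X_S\subseteq\{0,1\}^{\mathbb{Z}}$ is the subshift whose language $L(X_S)$ consists of all subwords of elements of $\{01^n : n\in S\}^*$ (finite concatenations of the words $01^n$, $n\in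 S$). *)

theory Defs
  imports "HOL-Analysis.Analysis" "HOL-Library.Sublist"
begin

definition shift :: "(int \<Rightarrow> 'a) \<Rightarrow> int \<Rightarrow> 'a" where
  "shift x = (\<lambda>i. x (i + 1))"

abbreviation full_shift :: "'a set \<Rightarrow> (int \<Rightarrow> 'a) topology" where
  "full_shift A \<equiv> product_topology (\<lambda>_. discrete_topology A) UNIV"

definition subshift :: "'a set \<Rightarrow> (int \<Rightarrow> 'a) set \<Rightarrow> bool" where
  "subshift A X \<longleftrightarrow>
     finite A \<and> A \<noteq> {} \<and> X \<noteq> {} \<and> closedin (full_shift A) X \<and> shift ` X = X"

text \<open>The empty word arises as the case \<open>j < i\<close>.\<close>

definition language :: "(int \<Rightarrow> 'a) set \<Rightarrow> 'a list set" where
  "language X = {map x [i..j] | x i j. x \<in> X}"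

definition sliding_block_code ::
    "(int \<Rightarrow> 'a) set \<Rightarrow> ((int \<Rightarrow> 'a) \<Rightarrow> (int \<Rightarrow> 'b)) \<Rightarrow> bool" where
  "sliding_block_code X F \<longleftrightarrow>
     (\<exists>m a f. m \<le> a \<and> (\<forall>x\<in>X. \<forall>i. F x i = f (map x [i + m..i + a])))"

definition conjugacy ::
    "((int \<Rightarrow> 'a) \<Rightarrow> (int \<Rightarrow> 'b)) \<Rightarrow> (int \<Rightarrow> 'a) set \<Rightarrow> (int \<Rightarrow> 'b) set \<Rightarrow> bool" where
  "conjugacy F X Y \<longleftrightarrow> bij_betw F X Y \<and> sliding_block_code X F"

definition conjugate :: "(int \<Rightarrow> 'a) set \<Rightarrow> (int \<Rightarrow> 'b) set \<Rightarrow> bool" where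
  "conjugate X Y \<longleftrightarrow> (\<exists>F. conjugacy F X Y)"

definition shift_prod ::
    "(int \<Rightarrow> 'a) set \<Rightarrow> (int \<Rightarrow> 'b) set \<Rightarrow> (int \<Rightarrow> 'a \<times> 'b) set" where
  "shift_prod Y Z = {\<lambda>i. (y i, z i) | y z. y \<in> Y \<and> z \<in> Z}"

definition trivial_shift :: "(int \<Rightarrow> 'a) set \<Rightarrow> bool" where
  "trivial_shift X \<longleftrightarrow> (\<exists>x. X = {x})"

text \<open>
  A definition cannot quantify over the types of the alphabets of the factors, so
  these range over the finite sets of natural numbers. This is no restriction:
  \<open>direct_prime_factors\<close> below obtains the property for factors over arbitrary
  alphabets.
\<close>

definition direct_prime :: "(int \<Rightarrow> 'a) set \<Rightarrow> bool" where
  "direct_prime X \<longleftrightarrow>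
     (\<forall>(A :: nat set) (B :: nat set) Y Z.
        subshift A Y \<longrightarrow> subshift B Z \<longrightarrow> conjugate X (shift_prod Y Z) \<longrightarrow>
        trivial_shift Y \<or> trivial_shift Z)"

text \<open>
  A left-infinite sequence \<open>l\<close> is indexed from right to left: \<open>l n\<close> is the letter at
  position \<open>-1 - n\<close>.
\<close>

definition right_tail :: "(int \<Rightarrow> 'a) \<Rightarrow> nat \<Rightarrow> 'a" where
  "right_tail x = (\<lambda>n. x (int n))"

definition left_tail :: "(int \<Rightarrow> 'a) \<Rightarrow> nat \<Rightarrow> 'a" where
  "left_tail x = (\<lambda>n. x (- 1 - int n))"

definition join :: "(nat \<Rightarrow> 'a) \<Rightarrow> (nat \<Rightarrow> 'a) \<Rightarrow> int \<Rightarrow> 'a" where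
  "join l r = (\<lambda>i. if 0 \<le> i then r (nat i) else l (nat (- 1 - i)))"

definition follower_set :: "(int \<Rightarrow> 'a) set \<Rightarrow> (nat \<Rightarrow> 'a) \<Rightarrow> (nat \<Rightarrow> 'a) set" where
  "follower_set X l = {r \<in> right_tail ` X. join l r \<in> X}"

definition sofic :: "(int \<Rightarrow> 'a) set \<Rightarrow> bool" where
  "sofic X \<longleftrightarrow> finite {follower_set X (left_tail x) | x. x \<in> X}"

definition gap_blocks :: "nat set \<Rightarrow> nat list set" where
  "gap_blocks S = {0 # replicate n 1 | n. n \<in> S}"

definition gap_language :: "nat set \<Rightarrow> nat list set" where
  "gap_language S = {u. \<exists>w \<in> concat ` lists (gap_blocks S). sublist u w}"

text \<open>
  By \<open>gap_shift_unique\<close> below, for nonempty \<open>S\<close> this is the unique subshift of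
  \<open>{0, 1}\<^sup>\<int>\<close> with language \<open>gap_language S\<close>.
\<close>

definition gap_shift :: "nat set \<Rightarrow> (int \<Rightarrow> nat) set" where
  "gap_shift S = {x. \<forall>i j. map x [i..j] \<in> gap_language S}"

lemma join_tails: "join (left_tail x) (right_tail x) = x"
  by (auto simp: join_def left_tail_def right_tail_def)

lemma topspace_full_shift: "topspace (full_shift A) = {x. \<forall>i. x i \<in> A}"
  by (auto simp: PiE_def)

lemma continuous_map_relabel:
  assumes "h ` A \<subseteq> B"
  shows "continuous_map (full_shift A) (full_shift B) (\<lambda>x i. h (x i))"
proof (subst continuous_map_componentwise_UNIV, rule allI)
  fix k :: int
  have 1: "continuous_map (full_shift A) (discrete_topology A) (\<lambda>x. x k)"
    by (rule continuous_map_product_projection) simp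
  have 2: "continuous_map (discrete_topology A) (discrete_topology B) h"
    using assms by auto
  show "continuous_map (full_shift A) (discrete_topology B) (\<lambda>x. h (x k))"
    using continuous_map_compose[OF 1 2] by (simp add: o_def)
qed

lemma subshift_letter: "subshift A X \<Longrightarrow> x \<in> X \<Longrightarrow> x i \<in> A"
  using closedin_subset[of "full_shift A" X] topspace_full_shift[of A]
  by (auto simp: subshift_def)

lemma closedin_preimage_relabel:
  assumes "h ` A \<subseteq> B" "closedin (full_shift B) X"
  shows "closedin (full_shift A) {x. (\<forall>i. x i \<in> A) \<and> (\<lambda>i. h (x i)) \<in> X}"
  using closedin_continuous_map_preimage[OF continuous_map_relabel[OF assms(1)] assms(2)]
  unfolding topspace_full_shift by simp

lemma subshift_shift_prod:
  assumes Y: "subshift A Y" and Z: "subshift B Z"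
  shows "subshift (A \<times> B) (shift_prod Y Z)"
proof -
  have eq: "shift_prod Y Z =
      {x. (\<forall>i. x i \<in> A \<times> B) \<and> (\<lambda>i. fst (x i)) \<in> Y} \<inter>
      {x. (\<forall>i. x i \<in> A \<times> B) \<and> (\<lambda>i. snd (x i)) \<in> Z}" (is "_ = ?R")
  proof
    show "shift_prod Y Z \<subseteq> ?R"
      using subshift_letter[OF Y] subshift_letter[OF Z] by (auto simp: shift_prod_def)
    show "?R \<subseteq> shift_prod Y Z"
    proof
      fix x assume x: "x \<in> ?R"
      have "x = (\<lambda>i. (fst (x i), snd (x i)))" by simp
      moreover have "(\<lambda>i. fst (x i)) \<in> Y" "(\<lambda>i. snd (x i)) \<in> Z" using x by simp_all
      ultimately show "x \<in> shift_prod Y Z"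
        unfolding shift_prod_def mem_Collect_eq by (intro exI conjI)
    qed
  qed
  have "closedin (full_shift (A \<times> B)) (shift_prod Y Z)"
    unfolding eq
    using Y Z by (intro closedin_Int closedin_preimage_relabel) (auto simp: subshift_def)
  moreover have "shift ` shift_prod Y Z = shift_prod Y Z"
  proof
    show "shift ` shift_prod Y Z \<subseteq> shift_prod Y Z"
    proof
      fix x assume "x \<in> shift ` shift_prod Y Z"
      then obtain y z where yz: "y \<in> Y" "z \<in> Z" "x = shift (\<lambda>i. (y i, z i))"
        by (auto simp: shift_prod_def)
      have "shift y \<in> Y" "shift z \<in> Z" using Y Z yz by (auto simp: subshift_def)
      moreover have "x = (\<lambda>i. (shift y i, shift z i))" using yz by (simp add: shift_def)
      ultimately show "x \<in> shift_prod Y Z" unfolding shift_prod_def by blast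
    qed
    show "shift_prod Y Z \<subseteq> shift ` shift_prod Y Z"
    proof
      fix x assume "x \<in> shift_prod Y Z"
      then obtain y z where yz: "y \<in> Y" "z \<in> Z" "x = (\<lambda>i. (y i, z i))"
        by (auto simp: shift_prod_def)
      have "y \<in> shift ` Y" "z \<in> shift ` Z" using Y Z yz by (auto simp: subshift_def)
      then obtain y' z' where "y' \<in> Y" "y = shift y'" "z' \<in> Z" "z = shift z'"
        by (elim imageE)
      moreover from this have "x = shift (\<lambda>i. (y' i, z' i))" using yz by (simp add: shift_def)
      ultimately show "x \<in> shift ` shift_prod Y Z" unfolding shift_prod_def by blast
    qed
  qed
  ultimately show ?thesis
    using Y Z by (auto simp: subshift_def shift_prod_def)
qed

lemma subshift_relabel:
  assumes X: "subshift A X" and g: "inj_on g A"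
  shows "subshift (g ` A) ((\<lambda>x i. g (x i)) ` X)" (is "subshift _ ?X'")
proof -
  let ?h = "inv_into A g"
  have h: "?h ` g ` A \<subseteq> A" using g by (auto simp: inv_into_f_f)
  have hg: "(\<lambda>i. ?h (g (x i))) = x" if "x \<in> X" for x
    using subshift_letter[OF X that] g by (auto simp: inv_into_f_f)
  have eq: "?X' = {x. (\<forall>i. x i \<in> g ` A) \<and> (\<lambda>i. ?h (x i)) \<in> X}" (is "_ = ?R")
  proof
    show "?X' \<subseteq> ?R" using subshift_letter[OF X] hg by auto
    show "?R \<subseteq> ?X'"
    proof
      fix x assume x: "x \<in> ?R"
      then have "x = (\<lambda>i. g (?h (x i)))" by (auto simp: f_inv_into_f)
      moreover have "(\<lambda>i. ?h (x i)) \<in> X" using x by simp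
      ultimately show "x \<in> ?X'" by (rule image_eqI)
    qed
  qed
  have "closedin (full_shift (g ` A)) ?X'"
    unfolding eq using X h by (intro closedin_preimage_relabel) (auto simp: subshift_def)
  moreover have "shift ` ?X' = ?X'"
  proof -
    have "shift ` ?X' = (\<lambda>x i. g (x i)) ` shift ` X" by (simp add: image_image shift_def)
    also have "shift ` X = X" using X by (simp add: subshift_def)
    finally show ?thesis .
  qed
  ultimately show ?thesis using X by (auto simp: subshift_def)
qed

lemma conjugate_relabel:
  assumes c: "conjugate X W" and inj: "inj_on (\<lambda>w i. k (w i)) W"
  shows "conjugate X ((\<lambda>w i. k (w i)) ` W)"
proof -
  obtain F where F: "bij_betw F X W" and s: "sliding_block_code X F"
    using c by (auto simp: conjugate_def conjugacy_def)
  obtain m a f where ma: "m \<le> a" and f: "\<forall>x\<in>X. \<forall>i. F x i = f (map x [i + m..i + a])"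
    using s by (auto simp: sliding_block_code_def)
  have "bij_betw ((\<lambda>w i. k (w i)) \<circ> F) X ((\<lambda>w i. k (w i)) ` W)"
    using F inj by (intro bij_betw_trans[OF F]) (auto simp: bij_betw_def)
  moreover have "sliding_block_code X ((\<lambda>w i. k (w i)) \<circ> F)"
    unfolding sliding_block_code_def
    using ma f by (intro exI[of _ m] exI[of _ a] exI[of _ "\<lambda>u. k (f u)"]) auto
  ultimately show ?thesis by (auto simp: conjugate_def conjugacy_def)
qed

lemma trivial_shift_inj:
  assumes "inj_on k V" "trivial_shift (k ` V)" shows "trivial_shift V"
proof -
  obtain x where x: "k ` V = {x}" using assms(2) by (auto simp: trivial_shift_def)
  then obtain v where v: "v \<in> V" by blast
  have "w = v" if "w \<in> V" for w
  proof (rule inj_onD[OF assms(1) _ that v])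
    have "k w \<in> {x}" "k v \<in> {x}" using that v unfolding x[symmetric] by (auto intro: imageI)
    then show "k w = k v" by simp
  qed
  with v have "V = {v}" by blast
  then show ?thesis unfolding trivial_shift_def by (rule exI[of _ v])
qed

lemma direct_prime_factors:
  fixes Y :: "(int \<Rightarrow> 'b) set" and Z :: "(int \<Rightarrow> 'c) set"
  assumes "direct_prime X" and Y: "subshift A Y" and Z: "subshift B Z"
    and c: "conjugate X (shift_prod Y Z)"
  shows "trivial_shift Y \<or> trivial_shift Z"
proof -
  have "finite A" "finite B" using Y Z by (auto simp: subshift_def)
  then obtain g :: "'b \<Rightarrow> nat" and h :: "'c \<Rightarrow> nat" where g: "inj_on g A" and h: "inj_on h B"
    using finite_imp_inj_to_nat_seg by metis
  define G where "G = (\<lambda>(x :: int \<Rightarrow> 'b) i. g (x i))"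
  define H where "H = (\<lambda>(x :: int \<Rightarrow> 'c) i. h (x i))"
  have injG: "inj_on G Y"
  proof (rule inj_onI, rule ext)
    fix x y i assume "x \<in> Y" "y \<in> Y" "G x = G y"
    moreover from this have "g (x i) = g (y i)" by (metis G_def)
    ultimately show "x i = y i" using g subshift_letter[OF Y] by (auto dest: inj_onD)
  qed
  have injH: "inj_on H Z"
  proof (rule inj_onI, rule ext)
    fix x y i assume "x \<in> Z" "y \<in> Z" "H x = H y"
    moreover from this have "h (x i) = h (y i)" by (metis H_def)
    ultimately show "x i = y i" using h subshift_letter[OF Z] by (auto dest: inj_onD)
  qed
  let ?K = "\<lambda>w i. map_prod g h (w i)"
  have K: "?K (\<lambda>i. (y i, z i)) = (\<lambda>i. (G y i, H z i))" for y z
    by (simp add: G_def H_def)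
  have "inj_on ?K (shift_prod Y Z)"
  proof (rule inj_onI)
    fix v w assume "v \<in> shift_prod Y Z" "w \<in> shift_prod Y Z" and e: "?K v = ?K w"
    then obtain y z y' z' where
      *: "y \<in> Y" "z \<in> Z" "v = (\<lambda>i. (y i, z i))" "y' \<in> Y" "z' \<in> Z" "w = (\<lambda>i. (y' i, z' i))"
      by (auto simp: shift_prod_def)
    have "G y = G y'" "H z = H z'"
      using e unfolding *(3,6) K by (auto dest: fun_cong)
    then show "v = w" using * injG injH by (auto dest: inj_onD)
  qed
  from conjugate_relabel[OF c this] have "conjugate X (?K ` shift_prod Y Z)" .
  also have "?K ` shift_prod Y Z = shift_prod (G ` Y) (H ` Z)"
  proof
    show "?K ` shift_prod Y Z \<subseteq> shift_prod (G ` Y) (H ` Z)"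
      unfolding shift_prod_def G_def H_def by fastforce
    show "shift_prod (G ` Y) (H ` Z) \<subseteq> ?K ` shift_prod Y Z"
    proof
      fix w assume "w \<in> shift_prod (G ` Y) (H ` Z)"
      then obtain y z where "y \<in> Y" "z \<in> Z" "w = ?K (\<lambda>i. (y i, z i))"
        unfolding K by (auto simp: shift_prod_def)
      moreover from this have "(\<lambda>i. (y i, z i)) \<in> shift_prod Y Z"
        unfolding shift_prod_def by blast
      ultimately show "w \<in> ?K ` shift_prod Y Z" by (intro image_eqI)
    qed
  qed
  finally have "conjugate X (shift_prod (G ` Y) (H ` Z))" .
  moreover have "subshift (g ` A) (G ` Y)" "subshift (h ` B) (H ` Z)"
    using subshift_relabel[OF Y g] subshift_relabel[OF Z h] by (simp_all add: G_def H_def)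
  ultimately have "trivial_shift (G ` Y) \<or> trivial_shift (H ` Z)"
    using assms(1) unfolding direct_prime_def by blast
  then show ?thesis using trivial_shift_inj[OF injG] trivial_shift_inj[OF injH] by argo
qed

lemma gap_language_sublist:
  "u \<in> gap_language S \<Longrightarrow> sublist v u \<Longrightarrow> v \<in> gap_language S"
  by (auto simp: gap_language_def intro: sublist_order.order_trans)

lemma gap_language_letters:
  assumes "u \<in> gap_language S" shows "set u \<subseteq> {0, 1}"
proof -
  obtain ws where ws: "ws \<in> lists (gap_blocks S)" "sublist u (concat ws)"
    using assms by (auto simp: gap_language_def)
  have "set w \<subseteq> {0, 1}" if "w \<in> gap_blocks S" for w
    using that by (auto simp: gap_blocks_def)
  then have "set (concat ws) \<subseteq> {0, 1}" using ws(1) by auto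
  then show ?thesis using set_mono_sublist[OF ws(2)] by blast
qed

lemma map_shift_upto: "map (shift x) [i..j] = map x [i + 1..j + 1]"
  by (rule nth_equalityI) (auto simp: shift_def nth_upto algebra_simps)

lemma gap_shift_closed: "closedin (full_shift {0, 1}) (gap_shift S)"
proof -
  let ?T = "full_shift {0, 1 :: nat}"
  have eq: "gap_shift S = (\<Inter>(i, j)\<in>UNIV.
      {x \<in> topspace ?T. map x [i..j] \<in> gap_language S})" (is "_ = ?R")
  proof
    show "?R \<subseteq> gap_shift S" by (auto simp: gap_shift_def)
    show "gap_shift S \<subseteq> ?R"
    proof
      fix x assume x: "x \<in> gap_shift S"
      have "x i \<in> {0, 1}" for i
      proof -
        have "map x [i..i] \<in> gap_language S" using x unfolding gap_shift_def by blast
        from gap_language_letters[OF this] show ?thesis by simp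
      qed
      then have "x \<in> topspace ?T" unfolding topspace_full_shift by blast
      then show "x \<in> ?R" using x by (auto simp: gap_shift_def)
    qed
  qed
  have cyl: "closedin ?T {x \<in> topspace ?T. map x ks \<in> L}" for ks L
  proof (induction ks arbitrary: L)
    case Nil
    have "{x \<in> topspace ?T. map x [] \<in> L} = (if [] \<in> L then topspace ?T else {})" by auto
    then show ?case by (cases "[] \<in> L") (simp_all only: if_True if_False closedin_topspace closedin_empty)
  next
    case (Cons k ks)
    have 1: "closedin ?T {x \<in> topspace ?T. x k = c}" if "c \<in> {0, 1}" for c
    proof -
      have "closedin ?T {x \<in> topspace ?T. x k \<in> {c}}"
        by (rule closedin_continuous_map_preimage[OF continuous_map_product_projection])
          (use that in auto)
      then show ?thesis by (simp only: singleton_iff)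
    qed
    have "{x \<in> topspace ?T. map x (k # ks) \<in> L} =
      (\<Union>c\<in>{0, 1}. {x \<in> topspace ?T. x k = c} \<inter> {x \<in> topspace ?T. map x ks \<in> {u. c # u \<in> L}})"
      unfolding topspace_full_shift by (intro set_eqI iffI) (simp_all, metis, (elim disjE conjE; simp))
    also have "closedin ?T \<dots>"
    proof (rule closedin_Union)
      fix V assume "V \<in> (\<lambda>c. {x \<in> topspace ?T. x k = c} \<inter>
          {x \<in> topspace ?T. map x ks \<in> {u. c # u \<in> L}}) ` {0, 1}"
      then obtain c where "c \<in> {0, 1}" and V: "V = {x \<in> topspace ?T. x k = c} \<inter>
          {x \<in> topspace ?T. map x ks \<in> {u. c # u \<in> L}}" by (rule imageE)
      then show "closedin ?T V" unfolding V by (intro closedin_Int 1 Cons.IH)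
    qed simp
    finally show ?case .
  qed
  show ?thesis unfolding eq by (rule closedin_Inter) (use cyl in auto)
qed

lemma gap_language_extend:
  assumes S: "S \<noteq> {}" and u: "u \<in> gap_language S"
  obtains x i j where "x \<in> gap_shift S" "map x [i..j] = u"
proof -
  obtain n where "n \<in> S" using S by blast
  then have b: "0 # replicate n 1 \<in> gap_blocks S" by (auto simp: gap_blocks_def)
  obtain ws where ws: "ws \<in> lists (gap_blocks S)" "sublist u (concat ws)"
    using u by (auto simp: gap_language_def)
  define w where "w = concat ws @ 0 # replicate n 1"
  have w: "w = concat (ws @ [0 # replicate n 1])" by (simp add: w_def)
  have ws': "ws @ [0 # replicate n 1] \<in> lists (gap_blocks S)" using ws(1) b by auto
  define l where "l = int (length w)"
  have l: "l > 0" by (simp add: l_def w_def)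
  define x where "x = (\<lambda>i. w ! nat (i mod l))"
  have period: "map x [c * l..c * l + l - 1] = w" for c
  proof (rule nth_equalityI)
    show "length (map x [c * l..c * l + l - 1]) = length w" by (simp add: l_def)
    fix k assume "k < length (map x [c * l..c * l + l - 1])"
    then have k: "k < length w" by (simp add: l_def)
    then have "map x [c * l..c * l + l - 1] ! k = x (c * l + int k)"
      by (simp add: l_def nth_upto)
    also have "\<dots> = w ! k" using k by (simp add: x_def l_def)
    finally show "map x [c * l..c * l + l - 1] ! k = w ! k" .
  qed
  have periods: "map x [c * l..c * l + int k * l - 1] = concat (replicate k w)" for c k
  proof (induction k arbitrary: c)
    case (Suc k)
    have pos: "1 \<le> l * int k" if "0 < k"
      using that l by (metis int_one_le_iff_zero_less mult_pos_pos of_nat_0_less_iff)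
    have e: "c * l + int (Suc k) * l - 1 = (c + 1) * l + int k * l - 1"
      by (simp add: algebra_simps)
    have "[c * l..c * l + int (Suc k) * l - 1] =
        [c * l..c * l + l - 1] @ [(c + 1) * l..(c + 1) * l + int k * l - 1]"
      unfolding e
      using upto_split1[of "c * l" "(c + 1) * l" "(c + 1) * l + int k * l - 1"] l
      by (cases "k = 0") (auto simp: algebra_simps pos)
    then show ?case using period[of c] Suc[of "c + 1"] by simp
  qed simp
  have "concat (replicate k w) \<in> concat ` lists (gap_blocks S)" for k
  proof -
    have "concat (replicate k w) = concat (concat (replicate k (ws @ [0 # replicate n 1])))"
      by (induction k) (simp_all add: w)
    moreover have "concat (replicate k (ws @ [0 # replicate n 1])) \<in> lists (gap_blocks S)"
      using ws' by (induction k) auto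
    ultimately show ?thesis by blast
  qed
  then have per: "map x [c * l..c * l + int k * l - 1] \<in> gap_language S" for c k
    unfolding periods gap_language_def by blast
  have "map x [i..j] \<in> gap_language S" for i j
  proof (cases "i \<le> j")
    case True
    define c where "c = i div l"
    define k where "k = nat (j div l + 1 - c)"
    have ci: "c * l \<le> i" using l by (simp add: c_def pos_mod_sign minus_mod_eq_div_mult[symmetric])
    have cj: "c \<le> j div l" using True l by (simp add: c_def zdiv_mono1)
    have "j < (j div l + 1) * l"
      using pos_mod_bound[OF l, of j] div_mult_mod_eq[of j l] unfolding distrib_right by linarith
    also have "\<dots> = c * l + int k * l" using cj by (simp add: k_def algebra_simps)
    finally have jk: "j \<le> c * l + int k * l - 1" by simp
    have "[c * l..c * l + int k * l - 1] =
        [c * l..i - 1] @ [i..j] @ [j + 1..c * l + int k * l - 1]"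
      using upto_split1[of "c * l" i "c * l + int k * l - 1"]
        upto_split2[of i j "c * l + int k * l - 1"] ci jk True by simp
    then have "sublist (map x [i..j]) (map x [c * l..c * l + int k * l - 1])"
      by (simp add: sublist_appendI)
    then show ?thesis using gap_language_sublist[OF per] by blast
  next
    case False
    then show ?thesis using per[of 0 0] by simp
  qed
  then have x: "x \<in> gap_shift S" by (simp add: gap_shift_def)
  obtain p s where ps: "w = p @ u @ s"
    using ws(2) by (auto simp: w_def sublist_def)
  have "map x [int (length p)..int (length p) + int (length u) - 1] = u"
  proof (rule nth_equalityI)
    fix k assume "k < length (map x [int (length p)..int (length p) + int (length u) - 1])"
    then have k: "k < length u" by simp
    have "x (int (length p) + int k) = w ! (length p + k)"
      using k by (simp add: x_def l_def ps nat_add_distrib)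
    then show "map x [int (length p)..int (length p) + int (length u) - 1] ! k = u ! k"
      using k by (simp add: ps nth_upto nth_append)
  qed simp
  with x show thesis by (rule that)
qed

lemma language_gap_shift: "S \<noteq> {} \<Longrightarrow> language (gap_shift S) = gap_language S"
proof
  show "language (gap_shift S) \<subseteq> gap_language S" by (auto simp: language_def gap_shift_def)
  show "gap_language S \<subseteq> language (gap_shift S)" if "S \<noteq> {}"
  proof
    fix u assume "u \<in> gap_language S"
    from gap_language_extend[OF that this] show "u \<in> language (gap_shift S)"
      unfolding language_def by blast
  qed
qed

lemma subshift_gap_shift:
  assumes S: "S \<noteq> {}" shows "subshift {0, 1} (gap_shift S)"
proof -
  have "[] \<in> gap_language S" by (auto simp: gap_language_def)
  then have ne: "gap_shift S \<noteq> {}" using gap_language_extend[OF S] by blast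
  have "shift ` gap_shift S = gap_shift S"
  proof
    show "shift ` gap_shift S \<subseteq> gap_shift S"
      by (auto simp: gap_shift_def map_shift_upto)
    show "gap_shift S \<subseteq> shift ` gap_shift S"
    proof
      fix x assume x: "x \<in> gap_shift S"
      define y where "y = (\<lambda>i. x (i - 1))"
      have xy: "x = shift y" by (simp add: y_def shift_def)
      have "map y [i..j] \<in> gap_language S" for i j
      proof -
        have "map y [i..j] = map x [i - 1..j - 1]" unfolding xy map_shift_upto by simp
        then show ?thesis using x by (simp add: gap_shift_def)
      qed
      then have "y \<in> gap_shift S" by (simp add: gap_shift_def)
      with xy show "x \<in> shift ` gap_shift S" by blast
    qed
  qed
  with ne gap_shift_closed show ?thesis unfolding subshift_def by blast
qed

lemma shift_translate:
  assumes "shift ` X = X" "x \<in> X" shows "(\<lambda>i. x (i + k)) \<in> X"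
proof -
  have up: "(\<lambda>i. x (i + int n)) \<in> X" if "x \<in> X" for n x
  proof (induction n)
    case (Suc n)
    then have "shift (\<lambda>i. x (i + int n)) \<in> X" using assms(1) by blast
    then show ?case by (simp add: shift_def algebra_simps)
  qed (use that in simp)
  have down: "(\<lambda>i. x (i - int n)) \<in> X" if "x \<in> X" for n x
  proof (induction n)
    case (Suc n)
    then obtain z where z: "z \<in> X" "(\<lambda>i. x (i - int n)) = shift z" using assms(1) by blast
    have "z = (\<lambda>i. x (i - int (Suc n)))"
    proof
      fix i
      show "z i = x (i - int (Suc n))"
        using fun_cong[OF z(2), of "i - 1"] by (simp add: shift_def algebra_simps)
    qed
    with z(1) show ?case by simp
  qed (use that in simp)
  show ?thesis
  proof (cases "0 \<le> k")
    case True
    then show ?thesis using up[OF assms(2), of "nat k"] by simp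
  next
    case False
    then show ?thesis using down[OF assms(2), of "nat (- k)"] by simp
  qed
qed

lemma mem_subshift_iff:
  assumes X: "subshift A X"
  shows "x \<in> X \<longleftrightarrow> (\<forall>i j. map x [i..j] \<in> language X)"
proof
  assume "x \<in> X" then show "\<forall>i j. map x [i..j] \<in> language X" by (auto simp: language_def)
next
  assume L: "\<forall>i j. map x [i..j] \<in> language X"
  have agree: "\<exists>y\<in>X. \<forall>k\<in>{i..j}. y k = x k" for i j
  proof -
    obtain y i' j' where y: "y \<in> X" "map x [i..j] = map y [i'..j']"
      using L unfolding language_def by blast
    have "(\<lambda>k. y (k + (i' - i))) \<in> X"
      using shift_translate X y(1) unfolding subshift_def by blast
    moreover have "y (k + (i' - i)) = x k" if "k \<in> {i..j}" for k
    proof -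
      have len: "nat (j - i + 1) = nat (j' - i' + 1)"
        using arg_cong[OF y(2), of length] by simp
      have "map x [i..j] ! nat (k - i) = x k" using that by (simp add: nth_upto)
      moreover have "map y [i'..j'] ! nat (k - i) = y (k + (i' - i))"
      proof -
        have "j - i + 1 = j' - i' + 1" using that len by auto
        then have "i' + int (nat (k - i)) \<le> j'" using that by auto
        then show ?thesis
          using that by (auto simp: nth_upto algebra_simps)
      qed
      ultimately show ?thesis using y(2) by simp
    qed
    ultimately show ?thesis by (intro bexI[of _ "\<lambda>k. y (k + (i' - i))"]) simp_all
  qed
  have xA: "x \<in> topspace (full_shift A)"
    unfolding topspace_full_shift
  proof (intro CollectI allI)
    fix i
    obtain y where "y \<in> X" "\<forall>k\<in>{i..i}. y k = x k" using agree[of i i] by blast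
    then show "x i \<in> A" using subshift_letter[OF X, of y i] by simp
  qed
  have "x \<in> full_shift A closure_of X"
    unfolding in_closure_of
  proof (intro conjI allI impI xA)
    fix T assume T: "x \<in> T \<and> openin (full_shift A) T"
    then obtain U where U: "finite {i. U i \<noteq> A}" "x \<in> Pi\<^sub>E UNIV U" "Pi\<^sub>E UNIV U \<subseteq> T"
      unfolding openin_product_topology_alt by auto
    obtain b where b: "\<forall>i\<in>{i. U i \<noteq> A}. \<bar>i\<bar> \<le> b"
    proof
      show "\<forall>i\<in>{i. U i \<noteq> A}. \<bar>i\<bar> \<le> Max (insert 0 (abs ` {i. U i \<noteq> A}))"
        using U(1) by (auto intro!: Max_ge)
    qed
    obtain y where y: "y \<in> X" "\<forall>k\<in>{- b..b}. y k = x k" using agree[of "- b" b] by blast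
    have "y i \<in> U i" for i
    proof (cases "U i = A")
      case True then show ?thesis using subshift_letter[OF X y(1)] by simp
    next
      case False
      then have "i \<in> {- b..b}" using b by auto
      then show ?thesis using y(2) U(2) by auto
    qed
    then have "y \<in> Pi\<^sub>E UNIV U" by auto
    then show "\<exists>y. y \<in> X \<and> y \<in> T" using y(1) U(3) by blast
  qed
  then show "x \<in> X" using X by (simp add: subshift_def closure_of_closedin)
qed

lemma gap_shift_unique:
  assumes "S \<noteq> {}"
  shows "subshift {0, 1} X \<and> language X = gap_language S \<longleftrightarrow> X = gap_shift S"
proof
  assume "subshift {0, 1} X \<and> language X = gap_language S"
  then show "X = gap_shift S"
    using mem_subshift_iff[of "{0, 1}" X] unfolding gap_shift_def by auto
next
  assume "X = gap_shift S"
  then show "subshift {0, 1} X \<and> language X = gap_language S"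
    using language_gap_shift[OF assms] subshift_gap_shift[OF assms] by metis
qed

end

theory Submission
  imports Defs
begin

text \<open>
  Let \<open>F\<close> be a conjugacy from the gap shift \<open>X\<close> to \<open>Y \<times> Z\<close>. The follower set of a point of
  \<open>Y \<times> Z\<close> at a position is determined by that of its preimage nearby together with finitely
  many letters, and conversely; hence \<open>Y \<times> Z\<close> has infinitely many follower sets, and so does
  one factor, say \<open>Y\<close>. In \<open>X\<close> the letter \<open>0\<close> is synchronizing, so the points with a \<open>0\<close> in
  a fixed window contribute only finitely many follower sets. Fix \<open>z \<in> Z\<close>. If for every
  \<open>y \<in> Y\<close> the preimage of \<open>(y, z)\<close> had a \<open>0\<close> in this window, then \<open>Y\<close> would have finitely
  many follower sets. So some preimage reads \<open>1 \<dots> 1\<close> there, which forces the letter of \<open>z\<close> at a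
  given position to be the one that the block map of \<open>F\<close> assigns to \<open>1 \<dots> 1\<close>. Thus \<open>Z\<close> has
  exactly one point.
\<close>

section \<open>Follower sets at a cut and local maps\<close>

definition glue :: "int \<Rightarrow> (int \<Rightarrow> 'a) \<Rightarrow> (int \<Rightarrow> 'a) \<Rightarrow> int \<Rightarrow> 'a" where
  "glue i x y = (\<lambda>k. if k < i then x k else y k)"

text \<open>Continuations are two-sided sequences of which only the part from \<open>i\<close> on
  enters, so cuts at different positions are compared without reindexing.\<close>

definition followers :: "(int \<Rightarrow> 'a) set \<Rightarrow> int \<Rightarrow> (int \<Rightarrow> 'a) \<Rightarrow> (int \<Rightarrow> 'a) set" where
  "followers X i x = {y. glue i x y \<in> X}"

text \<open>Locality as agreement on windows, with no block map: it suits an inverse given only by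
  \<open>inv_into\<close>, and with a symmetric radius one \<open>r\<close> serves a conjugacy and
  its inverse.\<close>

definition local_rule :: "int \<Rightarrow> (int \<Rightarrow> 'a) set \<Rightarrow> ((int \<Rightarrow> 'a) \<Rightarrow> int \<Rightarrow> 'b) \<Rightarrow> bool" where
  "local_rule r X F \<longleftrightarrow>
     (\<forall>x\<in>X. \<forall>x'\<in>X. \<forall>i. (\<forall>k\<in>{i - r..i + r}. x k = x' k) \<longrightarrow> F x i = F x' i)"

lemma local_ruleD:
  assumes "local_rule r X F" "x \<in> X" "x' \<in> X" "\<And>k. i - r \<le> k \<Longrightarrow> k \<le> i + r \<Longrightarrow> x k = x' k"
  shows "F x i = F x' i"
  by (rule assms(1)[unfolded local_rule_def, rule_format, OF assms(2,3)]) (simp add: assms(4))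

lemma local_rule_mono:
  assumes "local_rule r X F" "r \<le> s" shows "local_rule s X F"
  unfolding local_rule_def
proof (intro ballI allI impI)
  fix x x' i assume x: "x \<in> X" "x' \<in> X" "\<forall>k\<in>{i - s..i + s}. x k = x' k"
  then show "F x i = F x' i"
    using assms(2) by (intro local_ruleD[OF assms(1) x(1,2)]) simp
qed

section \<open>Finiteness of follower sets along a conjugacy\<close>

lemma finite_image_factor:
  assumes "finite (key ` T)" "\<And>x y. x \<in> T \<Longrightarrow> y \<in> T \<Longrightarrow> key x = key y \<Longrightarrow> g x = g y"
  shows "finite (g ` T)"
proof (rule finite_subset)
  show "finite ((\<lambda>k. g (inv_into T key k)) ` key ` T)" by (rule finite_imageI[OF assms(1)])
  show "g ` T \<subseteq> (\<lambda>k. g (inv_into T key k)) ` key ` T"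
  proof (rule image_subsetI)
    fix x assume x: "x \<in> T"
    have "g x = g (inv_into T key (key x))"
      by (rule assms(2)[OF x inv_into_into[OF imageI[OF x]] f_inv_into_f[OF imageI[OF x], symmetric]])
    then show "g x \<in> (\<lambda>k. g (inv_into T key k)) ` key ` T" using x by (intro image_eqI) auto
  qed
qed

lemma finite_words:
  assumes "subshift A X" "T \<subseteq> X"
  shows "finite ((\<lambda>x. map x ks) ` T)"
proof (rule finite_subset)
  show "(\<lambda>x. map x ks) ` T \<subseteq> {u. set u \<subseteq> A \<and> length u = length ks}"
  proof (intro image_subsetI CollectI conjI)
    fix x assume "x \<in> T"
    then have "x \<in> X" using assms(2) by blast
    then show "set (map x ks) \<subseteq> A" using subshift_letter[OF assms(1)] by auto
  qed simp
  show "finite {u. set u \<subseteq> A \<and> length u = length ks}"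
    using assms(1) by (intro finite_lists_length_eq) (simp add: subshift_def)
qed

text \<open>A continuation of \<open>w\<close> is pulled back by \<open>G\<close>, its part from
  \<open>- r\<close> on is pasted onto \<open>G w'\<close>, and the result is mapped forward by
  \<open>F\<close>. The pasted point equals \<open>G w'\<close> left of \<open>- r\<close> and,
  since \<open>G w\<close> and \<open>G w'\<close> agree on \<open>[- 3 * r, - r)\<close>, equals
  the pulled-back point from \<open>- 3 * r\<close> on. Every window of radius \<open>r\<close> lies
  in one of these two ranges.\<close>

lemma followers_factor:
  assumes "0 \<le> r" and F: "F ` X \<subseteq> W" "local_rule r X F" and G: "G ` W \<subseteq> X" "local_rule r W G"
    and FG: "\<And>w. w \<in> W \<Longrightarrow> F (G w) = w"
    and w: "w \<in> W" "w' \<in> W"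
    and fol: "followers X (- r) (G w) = followers X (- r) (G w')"
    and agree: "\<And>k. - 3 * r \<le> k \<Longrightarrow> k < - r \<Longrightarrow> G w k = G w' k"
      "\<And>k. - 2 * r \<le> k \<Longrightarrow> k < 0 \<Longrightarrow> w k = w' k"
  shows "followers W 0 w \<subseteq> followers W 0 w'"
proof
  fix v assume "v \<in> followers W 0 w"
  define u where "u = glue 0 w v"
  have u: "u \<in> W" using \<open>v \<in> _\<close> by (simp add: u_def followers_def)
  \<comment> \<open>The cut moves to \<open>- r\<close> because the window of such a
    \<open>k\<close> lies left of \<open>0\<close>, where \<open>u\<close> is still
    \<open>w\<close>.\<close>
  have Gu: "G u k = G w k" if "k < - r" for k
    using that by (intro local_ruleD[OF G(2) u w(1)]) (simp add: u_def glue_def)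
  have "glue (- r) (G w) (G u) = G u" by (auto simp: glue_def Gu)
  then have "G u \<in> followers X (- r) (G w)" using u G(1) by (auto simp: followers_def)
  define x where "x = glue (- r) (G w') (G u)"
  have x: "x \<in> X" using \<open>G u \<in> followers X (- r) (G w)\<close> unfolding fol
    by (simp add: x_def followers_def)
  have "F x = glue 0 w' v"
  proof
    fix k
    show "F x k = glue 0 w' v k"
    proof (cases "k < - 2 * r")
      case True
      have "F x k = F (G w') k"
        using True G(1) w by (intro local_ruleD[OF F(2) x]) (auto simp: x_def glue_def)
      then show ?thesis using True FG[OF w(2)] \<open>0 \<le> r\<close> by (simp add: glue_def)
    next
      case False
      have "F x k = F (G u) k"
        using False G(1) u by (intro local_ruleD[OF F(2) x]) (auto simp: x_def glue_def agree Gu)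
      then show ?thesis using False FG[OF u] agree(2) by (auto simp: u_def glue_def)
    qed
  qed
  moreover have "F x \<in> W" using F(1) x by blast
  ultimately show "v \<in> followers W 0 w'" by (simp add: followers_def)
qed

text \<open>The set \<open>T\<close> is arbitrary because the main argument takes for it a slice of
  the product with fixed second component.\<close>

lemma finite_followers_factor:
  assumes "0 \<le> r" and F: "F ` X \<subseteq> W" "local_rule r X F" and G: "G ` W \<subseteq> X" "local_rule r W G"
    and FG: "\<And>w. w \<in> W \<Longrightarrow> F (G w) = w"
    and X: "subshift A X" and W: "subshift B W"
    and T: "T \<subseteq> W" and fin: "finite (followers X (- r) ` G ` T)"
  shows "finite (followers W 0 ` T)"
proof (rule finite_image_factor)
  \<comment> \<open>These are the data compared in \<open>followers_factor\<close>: one of finitely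
    many follower sets and two words of fixed length over finite alphabets.\<close>
  let ?key = "\<lambda>w. (followers X (- r) (G w), map (G w) [- 3 * r..- r - 1], map w [- 2 * r..- 1])"
  have "?key ` T \<subseteq> (followers X (- r) ` G ` T) \<times>
      ((\<lambda>x. map x [- 3 * r..- r - 1]) ` G ` T) \<times> ((\<lambda>w. map w [- 2 * r..- 1]) ` T)"
    by auto
  moreover have "G ` T \<subseteq> X" using G(1) T by blast
  ultimately show "finite (?key ` T)"
    using fin finite_words[OF X] finite_words[OF W T] by (meson finite_SigmaI finite_subset)
  have "followers W 0 w \<subseteq> followers W 0 w'" if "w \<in> T" "w' \<in> T" "?key w = ?key w'" for w w'
    using that T by (intro followers_factor[OF assms(1) F G FG]) auto
  then show "followers W 0 w = followers W 0 w'"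
    if "w \<in> T" "w' \<in> T" "?key w = ?key w'" for w w'
    using that by (intro subset_antisym) auto
qed

lemma subshift_translate: "subshift A X \<Longrightarrow> x \<in> X \<Longrightarrow> (\<lambda>i. x (i + k)) \<in> X"
  using shift_translate unfolding subshift_def by blast

text \<open>Needed because \<open>finite_followers_factor\<close> compares a cut at
  \<open>- r\<close> with a cut at \<open>0\<close>.\<close>

lemma finite_followers_translate:
  assumes X: "subshift A X" and fin: "finite (followers X 0 ` X)"
  shows "finite (followers X i ` X)"
proof -
  have "followers X i x = {y. (\<lambda>k. y (k + i)) \<in> followers X 0 (\<lambda>k. x (k + i))}" for x
  proof -
    have "glue i x y \<in> X \<longleftrightarrow> (\<lambda>k. glue i x y (k + i)) \<in> X" for y
      using subshift_translate[OF X, of "glue i x y" i]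
        subshift_translate[OF X, of "\<lambda>k. glue i x y (k + i)" "- i"] by auto
    moreover have "(\<lambda>k. glue i x y (k + i)) = glue 0 (\<lambda>k. x (k + i)) (\<lambda>k. y (k + i))" for y
      by (auto simp: glue_def)
    ultimately show ?thesis by (simp add: followers_def)
  qed
  then have "followers X i ` X =
      (\<lambda>E. {y. (\<lambda>k. y (k + i)) \<in> E}) ` followers X 0 ` (\<lambda>x k. x (k + i)) ` X"
    by (simp add: image_image)
  moreover have "(\<lambda>x k. x (k + i)) ` X \<subseteq> X" using subshift_translate[OF X] by auto
  ultimately show ?thesis using fin by (metis finite_imageI finite_subset image_mono)
qed

lemma sofic_if_finite_followers:
  assumes "finite (followers X 0 ` X)" shows "sofic X"
proof -
  \<comment> \<open>For negative \<open>i\<close>, \<open>r (nat i)\<close> is the dummy value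
    \<open>r 0\<close>, which \<open>glue 0\<close> discards.\<close>
  have "join (left_tail x) r = glue 0 x (\<lambda>i. r (nat i))" for x :: "int \<Rightarrow> 'a" and r
    by (auto simp: join_def left_tail_def glue_def)
  then have "follower_set X (left_tail x) =
      {r \<in> right_tail ` X. (\<lambda>i. r (nat i)) \<in> followers X 0 x}" for x
    by (simp add: follower_set_def followers_def)
  then have "{follower_set X (left_tail x) | x. x \<in> X} =
      (\<lambda>E. {r \<in> right_tail ` X. (\<lambda>i. r (nat i)) \<in> E}) ` followers X 0 ` X"
    by auto
  then show ?thesis using assms by (simp add: sofic_def)
qed

section \<open>Follower sets of products\<close>

lemma zip_mem_shift_prod: "(\<lambda>i. (y i, z i)) \<in> shift_prod Y Z \<longleftrightarrow> y \<in> Y \<and> z \<in> Z"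
proof -
  have "y' = y \<and> z' = z" if "(\<lambda>i. (y i, z i)) = (\<lambda>i. (y' i, z' i))" for y' z'
    using arg_cong[OF that, of "\<lambda>w i. fst (w i)"] arg_cong[OF that, of "\<lambda>w i. snd (w i)"] by simp
  then show ?thesis unfolding shift_prod_def by auto
qed

lemma mem_shift_prod: "w \<in> shift_prod Y Z \<longleftrightarrow> (\<lambda>i. fst (w i)) \<in> Y \<and> (\<lambda>i. snd (w i)) \<in> Z"
  using zip_mem_shift_prod[of "\<lambda>i. fst (w i)" "\<lambda>i. snd (w i)"] by simp

lemma followers_shift_prod:
  "followers (shift_prod Y Z) i w =
     {v. (\<lambda>k. fst (v k)) \<in> followers Y i (\<lambda>k. fst (w k)) \<and>
         (\<lambda>k. snd (v k)) \<in> followers Z i (\<lambda>k. snd (w k))}"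
proof -
  have "(\<lambda>k. fst (glue i w v k)) = glue i (\<lambda>k. fst (w k)) (\<lambda>k. fst (v k))" for v
    by (auto simp: glue_def)
  moreover have "(\<lambda>k. snd (glue i w v k)) = glue i (\<lambda>k. snd (w k)) (\<lambda>k. snd (v k))" for v
    by (auto simp: glue_def)
  ultimately show ?thesis by (simp add: followers_def mem_shift_prod)
qed

lemma finite_followers_shift_prod:
  assumes "finite (followers Y 0 ` Y)" "finite (followers Z 0 ` Z)"
  shows "finite (followers (shift_prod Y Z) 0 ` shift_prod Y Z)"
proof (rule finite_image_factor)
  let ?key = "\<lambda>w. (followers Y 0 (\<lambda>k. fst (w k)), followers Z 0 (\<lambda>k. snd (w k)))"
  have "?key ` shift_prod Y Z \<subseteq> (followers Y 0 ` Y) \<times> (followers Z 0 ` Z)"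
    by (auto simp: mem_shift_prod)
  then show "finite (?key ` shift_prod Y Z)" using assms by (meson finite_SigmaI finite_subset)
qed (simp add: followers_shift_prod)

lemma finite_followers_fst:
  assumes z: "z \<in> Z"
    and fin: "finite (followers (shift_prod Y Z) 0 ` (\<lambda>y i. (y i, z i)) ` Y)"
  shows "finite (followers Y 0 ` Y)"
proof -
  \<comment> \<open>Since \<open>z\<close> continues itself, the follower set of
    \<open>(y, z)\<close> determines that of \<open>y\<close>.\<close>
  have "glue 0 z z = z" by (simp add: glue_def)
  then have "followers Y 0 y =
      {y'. (\<lambda>i. (y' i, z i)) \<in> followers (shift_prod Y Z) 0 (\<lambda>i. (y i, z i))}" for y
    using z unfolding followers_shift_prod by (simp add: followers_def)
  then have "followers Y 0 ` Y = (\<lambda>E. {y'. (\<lambda>i. (y' i, z i)) \<in> E}) `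
      followers (shift_prod Y Z) 0 ` (\<lambda>y i. (y i, z i)) ` Y"
    by (simp add: image_image)
  then show ?thesis using fin by simp
qed

section \<open>Sliding block codes and locality of their inverses\<close>

lemma sliding_block_code_translate:
  assumes "sliding_block_code X F" "x \<in> X" "(\<lambda>i. x (i + k)) \<in> X"
  shows "F (\<lambda>i. x (i + k)) = (\<lambda>i. F x (i + k))"
proof
  fix j
  obtain m a f where f: "\<forall>x\<in>X. \<forall>i. F x i = f (map x [i + m..i + a])"
    using assms(1) by (auto simp: sliding_block_code_def)
  have "map (\<lambda>i. x (i + k)) [j + m..j + a] = map x [j + k + m..j + k + a]"
    by (rule nth_equalityI) (auto simp: nth_upto algebra_simps)
  then show "F (\<lambda>i. x (i + k)) j = F x (j + k)" using f assms(2,3) by simp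
qed

lemma sliding_block_code_local:
  assumes "sliding_block_code X F" obtains r where "0 \<le> r" "local_rule r X F"
proof -
  obtain m a f where f: "\<forall>x\<in>X. \<forall>i. F x i = f (map x [i + m..i + a])"
    using assms by (auto simp: sliding_block_code_def)
  have "local_rule (\<bar>m\<bar> + \<bar>a\<bar>) X F"
    unfolding local_rule_def
  proof (intro ballI allI impI)
    fix x x' i
    assume *: "x \<in> X" "x' \<in> X" "\<forall>k\<in>{i - (\<bar>m\<bar> + \<bar>a\<bar>)..i + (\<bar>m\<bar> + \<bar>a\<bar>)}. x k = x' k"
    have "x k = x' k" if "k \<in> {i + m..i + a}" for k
      by (rule *(3)[rule_format]) (use that in auto)
    then have "map x [i + m..i + a] = map x' [i + m..i + a]" by simp
    then show "F x i = F x' i" using f *(1,2) by metis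
  qed
  then show thesis using that[of "\<bar>m\<bar> + \<bar>a\<bar>"] by simp
qed

lemma openin_full_shift_finite_dependence:
  assumes "finite K" and "\<And>x y. (\<And>k. k \<in> K \<Longrightarrow> x k = y k) \<Longrightarrow> P x = P y"
  shows "openin (full_shift A) {x \<in> topspace (full_shift A). P x}" (is "openin ?T ?U")
proof (subst openin_subopen, intro ballI)
  fix x assume x: "x \<in> ?U"
  let ?V = "Pi\<^sub>E UNIV (\<lambda>k. if k \<in> K then {x k} else A)"
  have xA: "\<forall>k. x k \<in> A" using x unfolding topspace_full_shift by simp
  have "openin ?T ?V"
    unfolding openin_PiE_gen using assms(1) xA by auto
  moreover have "x \<in> ?V" using xA by auto
  moreover have "?V \<subseteq> ?U"
  proof
    fix y assume y: "y \<in> ?V"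
    have "y k = x k" if "k \<in> K" for k using y that by (auto simp: PiE_iff dest: spec[of _ k])
    then have "P y = P x" using assms(2) by blast
    moreover have "y k \<in> A" for k using y xA by (auto simp: PiE_iff split: if_splits dest: spec[of _ k])
    ultimately show "y \<in> ?U" using x unfolding topspace_full_shift by simp
  qed
  ultimately show "\<exists>V. openin ?T V \<and> x \<in> V \<and> V \<subseteq> ?U" by blast
qed

lemma closedin_full_shift_finite_dependence:
  assumes "finite K" and "\<And>x y. (\<And>k. k \<in> K \<Longrightarrow> x k = y k) \<Longrightarrow> P x = P y"
  shows "closedin (full_shift A) {x \<in> topspace (full_shift A). P x}"
proof -
  have "openin (full_shift A) {x \<in> topspace (full_shift A). \<not> P x}"
    by (rule openin_full_shift_finite_dependence[OF assms(1)]) (use assms(2) in blast)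
  moreover have "topspace (full_shift A) - {x \<in> topspace (full_shift A). P x} =
      {x \<in> topspace (full_shift A). \<not> P x}" by blast
  ultimately show ?thesis unfolding closedin_def by auto
qed

text \<open>Compactness: if no \<open>n\<close> works, the pairs in \<open>X \<times> X\<close> that
  differ at \<open>0\<close> while their images agree on \<open>[- n, n]\<close> form a decreasing
  sequence of nonempty closed sets. A common element contradicts injectivity.\<close>

lemma inverse_local_at_0:
  assumes X: "subshift A X" and F: "sliding_block_code X F" and inj: "inj_on F X"
  obtains n :: nat where "\<And>x x'. x \<in> X \<Longrightarrow> x' \<in> X \<Longrightarrow>
    (\<And>k. \<bar>k\<bar> \<le> int n \<Longrightarrow> F x k = F x' k) \<Longrightarrow> x 0 = x' 0"
proof (rule ccontr)
  assume "\<not> thesis"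
  then have bad: "\<exists>x\<in>X. \<exists>x'\<in>X. (\<forall>k. \<bar>k\<bar> \<le> int n \<longrightarrow> F x k = F x' k) \<and> x 0 \<noteq> x' 0" for n
    using that by blast
  obtain m a f where f: "\<forall>x\<in>X. \<forall>i. F x i = f (map x [i + m..i + a])"
    using F by (auto simp: sliding_block_code_def)
  let ?T = "full_shift (A \<times> A)" and ?P = "shift_prod X X"
  \<comment> \<open>The condition uses \<open>f\<close> in place of \<open>F\<close>, so that on all
    of the full shift, also outside \<open>X\<close>, it depends on finitely many letters
    only.\<close>
  define Q where "Q = (\<lambda>n w. fst (w 0) \<noteq> snd (w 0) \<and> (\<forall>k. \<bar>k\<bar> \<le> int n \<longrightarrow>
    f (map (\<lambda>i. fst (w i)) [k + m..k + a]) = f (map (\<lambda>i. snd (w i)) [k + m..k + a])))"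
  define C where "C = (\<lambda>n. ?P \<inter> {w \<in> topspace ?T. Q n w})"
  have P: "subshift (A \<times> A) ?P" by (rule subshift_shift_prod[OF X X])
  have CP: "C n = {w \<in> ?P. Q n w}" for n
    using subshift_letter[OF P] unfolding C_def topspace_full_shift by blast
  have "closedin ?T (C n)" for n
    unfolding C_def
  proof (rule closedin_Int)
    show "closedin ?T ?P" using P by (simp add: subshift_def)
    let ?K = "insert 0 {- int n - \<bar>m\<bar>..int n + \<bar>a\<bar>}"
    show "closedin ?T {w \<in> topspace ?T. Q n w}"
    proof (rule closedin_full_shift_finite_dependence)
      fix v w :: "int \<Rightarrow> 'a \<times> 'a" assume vw: "\<And>k. k \<in> ?K \<Longrightarrow> v k = w k"
      have "map (\<lambda>i. h (v i)) [k + m..k + a] = map (\<lambda>i. h (w i)) [k + m..k + a]"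
        if "\<bar>k\<bar> \<le> int n" for h :: "'a \<times> 'a \<Rightarrow> 'a" and k
        using that by (auto intro!: arg_cong[of _ _ h] vw)
      moreover have "v 0 = w 0" by (rule vw) simp
      ultimately show "Q n v = Q n w" unfolding Q_def by metis
    qed simp
  qed
  moreover have "C n \<noteq> {}" for n
  proof -
    obtain x x' where "x \<in> X" "x' \<in> X" "\<forall>k. \<bar>k\<bar> \<le> int n \<longrightarrow> F x k = F x' k" "x 0 \<noteq> x' 0"
      using bad by blast
    then have "(\<lambda>i. (x i, x' i)) \<in> C n" using f by (simp add: CP zip_mem_shift_prod Q_def)
    then show ?thesis by blast
  qed
  moreover have "decseq C"
    unfolding decseq_def CP Q_def by auto
  moreover have "compact_space ?T"
    using X by (simp add: compact_space_product_topology compact_space_discrete_topology subshift_def)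
  ultimately have "(\<Inter>n. C n) \<noteq> {}" by (intro compact_space_imp_nest)
  then obtain w where w: "\<And>n. w \<in> C n" by blast
  define x x' where "x = (\<lambda>i. fst (w i))" and "x' = (\<lambda>i. snd (w i))"
  have xX: "x \<in> X" "x' \<in> X" using w[of 0] by (simp_all add: CP mem_shift_prod x_def x'_def)
  have "F x k = F x' k" for k
    using w[of "nat \<bar>k\<bar>"] f xX by (simp add: CP Q_def x_def x'_def)
  then have "x = x'" using inj xX by (intro inj_onD[OF inj]) auto
  then have "x 0 = x' 0" by simp
  then show False using w[of 0] by (simp add: CP Q_def x_def x'_def)
qed

lemma conjugacy_inverse_local:
  assumes X: "subshift A X" and F: "conjugacy F X W"
  obtains r where "0 \<le> r" "local_rule r W (inv_into X F)"
proof -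
  have F: "bij_betw F X W" "sliding_block_code X F" using F by (auto simp: conjugacy_def)
  obtain n where n: "\<And>x x'. x \<in> X \<Longrightarrow> x' \<in> X \<Longrightarrow>
      (\<And>k. \<bar>k\<bar> \<le> int n \<Longrightarrow> F x k = F x' k) \<Longrightarrow> x 0 = x' 0"
    using inverse_local_at_0[OF X F(2)] F(1) unfolding bij_betw_def by metis
  have "local_rule (int n) W (inv_into X F)"
    unfolding local_rule_def
  proof (intro ballI allI impI)
    fix w w' i assume w: "w \<in> W" "w' \<in> W" "\<forall>k\<in>{i - int n..i + int n}. w k = w' k"
    define x x' where "x = inv_into X F w" and "x' = inv_into X F w'"
    have x: "x \<in> X" "x' \<in> X" "F x = w" "F x' = w'"
      using F(1) w unfolding x_def x'_def bij_betw_def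
      by (auto intro: inv_into_into f_inv_into_f)
    \<comment> \<open>Translation by \<open>i\<close> carries the radius found at position
      \<open>0\<close> to every position.\<close>
    have tr: "F (\<lambda>k. x (k + i)) = (\<lambda>k. w (k + i))" "F (\<lambda>k. x' (k + i)) = (\<lambda>k. w' (k + i))"
      using sliding_block_code_translate[OF F(2)] subshift_translate[OF X] x by auto
    have "(\<lambda>k. x (k + i)) 0 = (\<lambda>k. x' (k + i)) 0"
      by (rule n[OF subshift_translate[OF X x(1)] subshift_translate[OF X x(2)]])
        (use w(3) in \<open>simp add: tr abs_le_iff\<close>)
    then show "inv_into X F w i = inv_into X F w' i" by (simp add: x_def x'_def)
  qed
  then show thesis using that[of "int n"] by simp
qed

section \<open>Synchronization in gap shifts\<close>

lemma replicate_append_split: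
  assumes "a \<noteq> b" "replicate n a @ u = p @ b # s"
  obtains q where "p = replicate n a @ q" "u = q @ b # s"
proof -
  have "\<exists>q. p = replicate n a @ q \<and> u = q @ b # s"
    using assms(2)
  proof (induction n arbitrary: p)
    case (Suc n)
    then show ?case using assms(1) by (cases p) auto
  qed simp
  then show thesis using that by blast
qed

text \<open>The only \<open>0\<close> of a block is its first letter, so each \<open>0\<close> of a
  concatenation marks a block boundary.\<close>

lemma concat_gap_blocks_split:
  assumes "ws \<in> lists (gap_blocks S)" "concat ws = p @ 0 # s"
  obtains us vs where "us \<in> lists (gap_blocks S)" "vs \<in> lists (gap_blocks S)"
    "concat us = p" "concat vs = 0 # s"
  using assms
proof (induction ws arbitrary: p thesis rule: list.induct)
  case Nil
  then show ?case by simp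
next
  case (Cons w ws)
  obtain n where n: "n \<in> S" "w = 0 # replicate n 1" using Cons.prems(2)
    by (auto simp: gap_blocks_def)
  show ?case
  proof (cases p)
    case Nil
    then show ?thesis using Cons.prems by (intro Cons.prems(1)[of "[]" "w # ws"]) auto
  next
    case p: (Cons b p')
    have eq: "replicate n 1 @ concat ws = p' @ 0 # s" and b: "b = 0"
      using Cons.prems(3) by (auto simp: p n(2))
    from replicate_append_split[OF _ eq]
    obtain q where q: "p' = replicate n 1 @ q" "concat ws = q @ 0 # s" by auto
    obtain us vs where "us \<in> lists (gap_blocks S)" "vs \<in> lists (gap_blocks S)"
      "concat us = q" "concat vs = 0 # s"
      using Cons.IH[OF _ _ q(2)] Cons.prems(2) by auto
    then show ?thesis using Cons.prems(2)
      by (intro Cons.prems(1)[of "w # us" vs]) (auto simp: p b q n(2))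
  qed
qed

text \<open>The letter \<open>0\<close> is synchronizing: both concatenations are cut in front of
  the common \<open>0\<close>, and the first part of one is followed by the second part of the
  other.\<close>

lemma gap_language_glue:
  assumes "u @ [0] \<in> gap_language S" "0 # v \<in> gap_language S"
  shows "u @ 0 # v \<in> gap_language S"
proof -
  obtain ws p s where ws: "ws \<in> lists (gap_blocks S)" "concat ws = (p @ u) @ 0 # s"
    using assms(1) by (auto simp: gap_language_def sublist_def)
  obtain ws' p' s' where ws': "ws' \<in> lists (gap_blocks S)" "concat ws' = p' @ 0 # (v @ s')"
    using assms(2) by (auto simp: gap_language_def sublist_def)
  obtain us where us: "us \<in> lists (gap_blocks S)" "concat us = p @ u"
    using concat_gap_blocks_split[OF ws] by metis
  obtain vs where vs: "vs \<in> lists (gap_blocks S)" "concat vs = 0 # v @ s'"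
    using concat_gap_blocks_split[OF ws'] by metis
  have "concat (us @ vs) = p @ (u @ 0 # v) @ s'" using us vs by simp
  moreover have "us @ vs \<in> lists (gap_blocks S)" using us vs by auto
  ultimately show ?thesis unfolding gap_language_def
    by (metis (mono_tags, lifting) imageI mem_Collect_eq sublist_appendI)
qed

lemma glue_gap_shift:
  assumes x: "x \<in> gap_shift S" and y: "y \<in> gap_shift S" and 0: "x k = 0" "y k = 0"
  shows "glue k x y \<in> gap_shift S"
  unfolding gap_shift_def
proof (intro CollectI allI)
  fix i j
  have L: "map x [i..j] \<in> gap_language S" "map y [i..j] \<in> gap_language S" for i j
    using x y by (auto simp: gap_shift_def)
  consider "j < k" | "k \<le> i" | "i < k" "k \<le> j" by linarith
  then show "map (glue k x y) [i..j] \<in> gap_language S"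
  proof cases
    case 1
    then have "map (glue k x y) [i..j] = map x [i..j]" by (simp add: glue_def)
    then show ?thesis using L by metis
  next
    case 2
    then have "map (glue k x y) [i..j] = map y [i..j]" by (simp add: glue_def)
    then show ?thesis using L by metis
  next
    case 3
    have "map x [i..k - 1] @ [0] \<in> gap_language S"
      using L(1)[of i k] 3 0 upto_rec2[of i k] by simp
    moreover have "0 # map y [k + 1..j] \<in> gap_language S"
      using L(2)[of k j] 3 0 upto_rec1[of k j] by simp
    ultimately have "map x [i..k - 1] @ 0 # map y [k + 1..j] \<in> gap_language S"
      by (rule gap_language_glue)
    moreover have "map (glue k x y) [i..j] = map x [i..k - 1] @ 0 # map y [k + 1..j]"
      using 3 0 upto_split3[of i k j] by (auto simp: glue_def)
    ultimately show ?thesis by simp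
  qed
qed

text \<open>Whatever continues \<open>x\<close> at \<open>i\<close> also continues
  \<open>x'\<close>: the continued point still has its \<open>0\<close> at \<open>k\<close> and can
  be glued there onto \<open>x'\<close>, with which it agrees on \<open>[k, i)\<close>.\<close>

lemma followers_gap_shift_eq:
  assumes x: "x \<in> gap_shift S" "x' \<in> gap_shift S" and k: "k < i" "x k = 0"
    and agree: "\<And>l. k \<le> l \<Longrightarrow> l < i \<Longrightarrow> x l = x' l"
  shows "followers (gap_shift S) i x = followers (gap_shift S) i x'"
proof -
  \<comment> \<open>Stated for general \<open>a\<close> and \<open>b\<close> to give both
    inclusions.\<close>
  have "glue i b y \<in> gap_shift S"
    if "b \<in> gap_shift S" "a k = 0" "\<And>l. k \<le> l \<Longrightarrow> l < i \<Longrightarrow> a l = b l" "glue i a y \<in> gap_shift S"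
    for a b y
  proof -
    have "glue i b y = glue k b (glue i a y)" using that(3) k by (auto simp: glue_def)
    moreover have "glue k b (glue i a y) \<in> gap_shift S"
      using that k by (intro glue_gap_shift[OF that(1,4)]) (simp_all add: glue_def)
    ultimately show ?thesis by simp
  qed
  then show ?thesis using assms unfolding followers_def by (intro Collect_cong) (metis order.refl)
qed

section \<open>Factors of a gap shift\<close>

lemma gap_shift_factor_constant:
  assumes X: "subshift {0, 1} (gap_shift S)"
    and Y: "subshift A Y" and Z: "subshift B Z"
    and F: "conjugacy F (gap_shift S) (shift_prod Y Z)"
    and inf: "infinite (followers Y 0 ` Y)"
  shows "trivial_shift Z"
proof -
  let ?X = "gap_shift S" and ?W = "shift_prod Y Z"
  define G where "G = inv_into ?X F"
  have bij: "bij_betw F ?X ?W" and sl: "sliding_block_code ?X F"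
    using F by (auto simp: conjugacy_def)
  obtain m a f where f: "\<forall>x\<in>?X. \<forall>i. F x i = f (map x [i + m..i + a])"
    using sl by (auto simp: sliding_block_code_def)
  obtain r1 where r1: "0 \<le> r1" "local_rule r1 ?X F" using sliding_block_code_local[OF sl] .
  obtain r2 where r2: "0 \<le> r2" "local_rule r2 ?W G"
    using conjugacy_inverse_local[OF X F] unfolding G_def .
  \<comment> \<open>Adding \<open>\<bar>m\<bar> + \<bar>a\<bar>\<close> puts the block window
    \<open>[j + m, j + a]\<close> of \<open>j = - 2 * r - 1\<close> inside
    \<open>[- 3 * r - 1, - r - 1]\<close>, hence left of the cut at \<open>- r\<close>.\<close>
  define r where "r = r1 + r2 + \<bar>m\<bar> + \<bar>a\<bar>"
  have r: "0 \<le> r" "local_rule r ?X F" "local_rule r ?W G"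
    using r1 r2 by (auto simp: r_def intro: local_rule_mono)
  have FX: "F ` ?X \<subseteq> ?W" and GW: "G ` ?W \<subseteq> ?X"
    using bij by (auto simp: G_def bij_betw_def inv_into_into)
  have FG: "F (G w) = w" if "w \<in> ?W" for w
    using bij that by (simp add: G_def bij_betw_def f_inv_into_f)
  \<comment> \<open>The second component of the block map on the all-\<open>1\<close> word;
    \<open>[m..a]\<close> only supplies its length.\<close>
  define c where "c = snd (f (map (\<lambda>_. 1) [m..a]))"
  have c: "z j = c" if "z \<in> Z" "j = - 2 * r - 1" for z j
  proof (rule ccontr)
    assume "z j \<noteq> c"
    let ?T = "(\<lambda>y i. (y i, z i)) ` Y"
    have T: "?T \<subseteq> ?W" using that(1) by (auto simp: zip_mem_shift_prod)
    \<comment> \<open>A preimage without a \<open>0\<close> in this range would read only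
      \<open>1\<close> in the block window of \<open>j\<close>, forcing
      \<open>z j = c\<close>.\<close>
    have zero: "\<exists>k. - 3 * r - 1 \<le> k \<and> k < - r \<and> x k = 0" if "x \<in> G ` ?T" for x
    proof (rule ccontr)
      assume no: "\<not> ?thesis"
      obtain y where y: "y \<in> Y" "x = G (\<lambda>i. (y i, z i))" using \<open>x \<in> G ` ?T\<close> by blast
      have xX: "x \<in> ?X" using \<open>x \<in> G ` ?T\<close> GW T by blast
      have "x k = 1" if "k \<in> {j + m..j + a}" for k
      proof -
        have "- 3 * r - 1 \<le> k" "k < - r"
          using that \<open>j = _\<close> r1(1) r2(1) unfolding r_def by auto
        then show ?thesis using no subshift_letter[OF X xX, of k] by auto
      qed
      then have "map x [j + m..j + a] = map (\<lambda>_. 1) [m..a]"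
        by (intro nth_equalityI) (auto simp: nth_upto)
      then have "snd (F x j) = c" using f xX by (simp add: c_def)
      moreover have "F x = (\<lambda>i. (y i, z i))"
        using y FG \<open>z \<in> Z\<close> by (simp add: zip_mem_shift_prod)
      ultimately show False using \<open>z j \<noteq> c\<close> by simp
    qed
    have "finite (followers ?X (- r) ` G ` ?T)"
    proof (rule finite_image_factor)
      \<comment> \<open>The word reaches up to the cut and contains a \<open>0\<close>, so by
        synchronization it determines the follower set.\<close>
      let ?key = "\<lambda>x :: int \<Rightarrow> nat. map x [- 3 * r - 1..- r - 1]"
      show "finite (?key ` G ` ?T)" using finite_words[OF X order.trans[OF image_mono[OF T] GW]] .
      fix x x' assume x: "x \<in> G ` ?T" "x' \<in> G ` ?T" "?key x = ?key x'"
      obtain k where "- 3 * r - 1 \<le> k" "k < - r" "x k = 0" using zero[OF x(1)] by blast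
      then show "followers ?X (- r) x = followers ?X (- r) x'"
        using x by (intro followers_gap_shift_eq subsetD[OF order.trans[OF image_mono[OF T] GW]]) auto
    qed
    from finite_followers_factor[OF r(1) FX r(2) GW r(3) FG X subshift_shift_prod[OF Y Z] T this]
    have "finite (followers ?W 0 ` ?T)" by simp
    then show False using finite_followers_fst[OF that(1)] inf by blast
  qed
  \<comment> \<open>As \<open>Z\<close> is invariant under translation, the claim at the single
    position \<open>j\<close> covers every position.\<close>
  have "z = (\<lambda>_. c)" if "z \<in> Z" for z
  proof
    fix i
    show "z i = c"
      using c[OF subshift_translate[OF Z that, of "i + 2 * r + 1"] refl] by simp
  qed
  moreover have "Z \<noteq> {}" using Z by (simp add: subshift_def)
  ultimately show ?thesis unfolding trivial_shift_def by blast
qed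

lemma conjugate_shift_prod_swap:
  assumes "conjugate X (shift_prod Y Z)" shows "conjugate X (shift_prod Z Y)"
proof -
  let ?K = "\<lambda>w i. prod.swap (w i)"
  have "inj_on ?K (shift_prod Y Z)"
  proof (intro inj_onI ext)
    fix v w i assume e: "?K v = ?K w"
    show "v i = w i" using fun_cong[OF e, of i] by (simp add: prod_eq_iff)
  qed
  from conjugate_relabel[OF assms this] have "conjugate X (?K ` shift_prod Y Z)" .
  moreover have "?K ` shift_prod Y Z = shift_prod Z Y"
  proof
    show "?K ` shift_prod Y Z \<subseteq> shift_prod Z Y" by (auto simp: mem_shift_prod)
    show "shift_prod Z Y \<subseteq> ?K ` shift_prod Y Z"
    proof
      fix w assume "w \<in> shift_prod Z Y"
      then show "w \<in> ?K ` shift_prod Y Z"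
        by (intro image_eqI[of _ _ "?K w"]) (auto simp: mem_shift_prod)
    qed
  qed
  ultimately show ?thesis by simp
qed

lemma sofic_if_conjugate_finite_followers:
  assumes X: "subshift A X" and W: "subshift B W" and F: "conjugacy F X W"
    and fin: "finite (followers W 0 ` W)"
  shows "sofic X"
proof -
  define G where "G = inv_into X F"
  have bij: "bij_betw F X W" and sl: "sliding_block_code X F"
    using F by (auto simp: conjugacy_def)
  obtain r1 where r1: "0 \<le> r1" "local_rule r1 X F" using sliding_block_code_local[OF sl] .
  obtain r2 where r2: "0 \<le> r2" "local_rule r2 W G"
    using conjugacy_inverse_local[OF X F] unfolding G_def .
  have r: "0 \<le> r1 + r2" "local_rule (r1 + r2) X F" "local_rule (r1 + r2) W G"
    using r1 r2 by (auto intro: local_rule_mono)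
  have "finite (followers X 0 ` X)"
  \<comment> \<open>The roles of \<open>X\<close> and \<open>W\<close>, and of \<open>F\<close> and
    \<open>G\<close>, are exchanged here.\<close>
  proof (rule finite_followers_factor[OF r(1) _ r(3) _ r(2) _ W X order.refl])
    show "finite (followers W (- (r1 + r2)) ` F ` X)"
      using finite_followers_translate[OF W fin] bij by (simp add: bij_betw_def)
  qed (use bij in \<open>auto simp: G_def bij_betw_def inv_into_into\<close>)
  then show ?thesis by (rule sofic_if_finite_followers)
qed

theorem theorem5p2:
  fixes S :: "nat set"
  assumes "S \<noteq> {}" and "\<not> sofic (gap_shift S)"
  shows "direct_prime (gap_shift S)"
  unfolding direct_prime_def
proof (intro allI impI)
  fix A B :: "nat set" and Y Z
  assume Y: "subshift A Y" and Z: "subshift B Z" and c: "conjugate (gap_shift S) (shift_prod Y Z)"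
  note X = subshift_gap_shift[OF assms(1)]
  obtain F where F: "conjugacy F (gap_shift S) (shift_prod Y Z)"
    using c by (auto simp: conjugate_def)
  \<comment> \<open>If both factors had finitely many follower sets, so would the product, and the
    gap shift would be sofic.\<close>
  have "infinite (followers Y 0 ` Y) \<or> infinite (followers Z 0 ` Z)"
    using sofic_if_conjugate_finite_followers[OF X subshift_shift_prod[OF Y Z] F]
      finite_followers_shift_prod assms(2) by blast
  then show "trivial_shift Y \<or> trivial_shift Z"
  proof
    assume "infinite (followers Y 0 ` Y)"
    then show ?thesis using gap_shift_factor_constant[OF X Y Z F] by blast
  next
    assume inf: "infinite (followers Z 0 ` Z)"
    obtain F' where "conjugacy F' (gap_shift S) (shift_prod Z Y)"
      using conjugate_shift_prod_swap[OF c] by (auto simp: conjugate_def)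
    then show ?thesis using gap_shift_factor_constant[OF X Z Y _ inf] by blast
  qed
qed

end
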